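(* Let $q$ be a prime power and let $n,\ell$ be integers with $\ell\ge 2n\ge 4$. Let $2\le x\le (q-1)^{\frac n2}q^{\frac{\ell-2n+1}{2}}$. Then there are no non-trivial Cameron-Liebler sets in ${\rm Bil}_q(n,\ell)$ with parameter $x$; that is, every Cameron-Liebler set in ${\rm Bil}_q(n,\ell)$ with parameter $x$ is a union of $x$ intersecting families.
   Context: Let $E=\langle e_{n+1},\dots,e_{n+\ell}\rangle\subseteq\mathbb F_q^{n+\ell}$, where $e_i$ are the standard basis vectors. For $1\le m\le n$, $\mathcal M_m$ is the set of $m$-dimensional subspaces $P$ of $\mathbb F_q^{n+\ell}$ with $P\cap E=\{0\}$. The bilinear forms graph ${\rm Bil}_q(n,\ell)$ has vertex set $\mathcal M_n$, two vertices being adjacent if their intersection has dimension $n-1$. Let $M$ be the real $0/1$ incidence matrix with rows indexed by $\mathcal M_1$ and columns indexed by $\mathcal M_n$ (entry $1$ iff the one-dimensional subspace is contained in the $n$-dimensional one). For $\mathcal S\subseteq\mathcal M_n$, $\chi_{\mathcal S}\in\mathbb R^{\mathcal M_n}$ is its characteristic vector. A subset $\mathcal L\subseteq\mathcal M_n$ is a Cameron-Liebler set in ${\rm Bil}_q(n,\ell)$ with parameter $x=q^{-(n-1)\ell}|\mathcal L|$ if $\chi_{\mathcal L}\in{\rm Im}(M^t)$ (over $\mathbb R$). A family $\mathcal F\subseteq\mathcal M_n$ is intersecting if $\dim(\pi\cap\pi')\ge1$ for all $\pi,\pi'\in\mathcal F$. A Cameron-Liebler set with parameter $x$ is trivial if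 it is a union of $x$ intersecting families, and non-trivial otherwise. *)

theory Defs
  imports "HOL-Analysis.Analysis"
begin

text \<open>
  The ambient space \<open>F\<^sub>q\<^bsup>n+\<ell>\<^esup>\<close> is \<open>'a ^ ('n + 'l)\<close> with \<open>'a\<close> a finite field, \<open>q = CARD('a)\<close>,
  \<open>n = CARD('n)\<close>, \<open>\<ell> = CARD('l)\<close>. The indices \<open>Inl i\<close> play the role of \<open>1, \<dots>, n\<close> and the indices
  \<open>Inr j\<close> that of \<open>n+1, \<dots>, n+\<ell>\<close>. Subspaces, span and dimension over \<open>'a\<close> are those of the
  library interpretation \<open>vec\<close>.
\<close>

definition E_space :: "('a::{field,finite} ^ ('n::finite + 'l::finite)) set" where
  "E_space = vec.span (range (\<lambda>j. axis (Inr j) 1))"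

definition M_set :: "nat \<Rightarrow> ('a::{field,finite} ^ ('n::finite + 'l::finite)) set set" where
  "M_set m = {P. vec.subspace P \<and> vec.dim P = m \<and> P \<inter> E_space = {0}}"

text \<open>The vertex set of \<open>Bil\<^sub>q(n,\<ell>)\<close>.\<close>

abbreviation bil_vertices :: "('a::{field,finite} ^ ('n::finite + 'l::finite)) set set" where
  "bil_vertices \<equiv> M_set CARD('n)"

definition incidence ::
  "('a::{field,finite} ^ ('n::finite + 'l::finite)) set \<Rightarrow> ('a ^ ('n + 'l)) set \<Rightarrow> real" where
  "incidence P \<pi> = (if P \<subseteq> \<pi> then 1 else 0)"

text \<open>
  Vectors indexed by a set \<open>X\<close> of subspaces are functions that are undefined outside \<open>X\<close>, that is,
  members of \<open>X \<rightarrow>\<^sub>E UNIV\<close>.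
\<close>

definition char_vec ::
  "('a::{field,finite} ^ ('n::finite + 'l::finite)) set set \<Rightarrow> ('a ^ ('n + 'l)) set \<Rightarrow> real" where
  "char_vec S = (\<lambda>\<pi>\<in>bil_vertices. indicator S \<pi>)"

definition transpose_mult ::
  "(('a::{field,finite} ^ ('n::finite + 'l::finite)) set \<Rightarrow> real) \<Rightarrow> ('a ^ ('n + 'l)) set \<Rightarrow> real" where
  "transpose_mult v = (\<lambda>\<pi>\<in>bil_vertices. \<Sum>P\<in>M_set 1. incidence P \<pi> * v P)"

definition image_transpose :: "(('a::{field,finite} ^ ('n::finite + 'l::finite)) set \<Rightarrow> real) set" where
  "image_transpose = transpose_mult ` (M_set 1 \<rightarrow>\<^sub>E UNIV)"

definition cameron_liebler ::
  "real \<Rightarrow> ('a::{field,finite} ^ ('n::finite + 'l::finite)) set set \<Rightarrow> bool" where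
  "cameron_liebler x L \<longleftrightarrow>
     L \<subseteq> bil_vertices \<and> char_vec L \<in> image_transpose \<and>
     x = real (card L) / real CARD('a) ^ ((CARD('n) - 1) * CARD('l))"

definition intersecting_family ::
  "('a::{field,finite} ^ ('n::finite + 'l::finite)) set set \<Rightarrow> bool" where
  "intersecting_family F \<longleftrightarrow>
     F \<subseteq> bil_vertices \<and> (\<forall>\<pi>\<in>F. \<forall>\<pi>'\<in>F. vec.dim (\<pi> \<inter> \<pi>') \<ge> 1)"

text \<open>
  The parameter is a priori only a rational number; being a union of \<open>x\<close> families includes
  the assertion that \<open>x\<close> is a natural number.
\<close>

definition trivial_with_parameter ::
  "real \<Rightarrow> ('a::{field,finite} ^ ('n::finite + 'l::finite)) set set \<Rightarrow> bool" where
  "trivial_with_parameter x L \<longleftrightarrow>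
     (\<exists>(k::nat) F. real k = x \<and> (\<forall>i<k. intersecting_family (F i)) \<and> L = (\<Union>i<k. F i))"

end

theory Submission
  imports Defs
begin

text \<open>
  Vertices are graphs of matrices \<open>A\<close>, and the indicator of \<open>L\<close> becomes \<open>h + (\<Sum>u. k u (A u))\<close> with
  every \<open>k u\<close> of mean zero. Averaging over a pencil \<open>{A. A u = v}\<close> or over a line \<open>A + v y\<^sup>T\<close> kills all
  terms that are not constant there, so the resulting densities are partial sums of the values \<open>k u (A u)\<close>.
  If some \<open>B \<notin> L\<close> lies in the pencil or line, then the densities of all pencils (lines) through \<open>B\<close>
  have a small sum; hence each density is \<open>1\<close> or small. For \<open>A \<in> L\<close> the lines through \<open>A\<close> have
  average density about \<open>1 / q\<close>, so about that proportion of them lies in \<open>L\<close>, and the second moment over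
  the hyperplanes \<open>y\<close> forces the squares of the densities of the pencils through \<open>A\<close> to sum to nearly
  \<open>1\<close>. As the densities themselves also sum to about \<open>1\<close>, they are not all small. Two pencils contained
  in \<open>L\<close> with independent directions would share a matrix whose pencil densities sum to at least \<open>2\<close>,
  so all contained pencils have the same direction and \<open>L\<close> is their disjoint union.
\<close>

section \<open>Hyperplane sums over a finite field\<close>

definition dotp :: "'a::comm_ring_1 ^ 'n::finite \<Rightarrow> 'a ^ 'n \<Rightarrow> 'a" where
  "dotp y u = (\<Sum>i\<in>UNIV. y $ i * u $ i)"

definition outer :: "'a::comm_ring_1 ^ 'l::finite \<Rightarrow> 'a ^ 'n::finite \<Rightarrow> 'a ^ 'n ^ 'l" where
  "outer v y = (\<chi> i j. v $ i * y $ j)"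

lemma dotp_commute: "dotp y u = dotp u y"
  by (simp add: dotp_def mult.commute)

lemma dotp_add_left: "dotp (y + z) u = dotp y u + dotp z u"
  by (simp add: dotp_def algebra_simps sum.distrib)

lemma dotp_diff_left: "dotp (y - z) u = dotp y u - dotp z u"
  by (simp add: dotp_def algebra_simps sum_subtractf)

lemma dotp_scale_left: "dotp (c *s y) u = c * dotp y u"
  by (simp add: dotp_def sum_distrib_left mult.assoc)

lemma dotp_scale_right: "dotp y (c *s u) = c * dotp y u"
  by (metis dotp_commute dotp_scale_left)

lemma dotp_zero [simp]: "dotp 0 u = 0" "dotp y 0 = 0"
  by (simp_all add: dotp_def)

lemma dotp_axis: "dotp (axis i c) u = c * u $ i"
  by (simp add: dotp_def axis_def if_distrib[of "\<lambda>x. x * _"] cong: if_cong)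

lemma outer_mult_vec: "outer v y *v u = dotp y u *s v"
  by (simp add: vec_eq_iff matrix_vector_mult_def outer_def dotp_def sum_distrib_left algebra_simps)

lemma add_outer_mult_vec: "(A + outer v y) *v u = A *v u + dotp y u *s v"
  by (simp add: matrix_vector_mult_add_rdistrib outer_mult_vec)

text \<open>The functional \<open>e\<close> reads off, at a coordinate \<open>j\<close>, the
  difference between \<open>w\<close> and the multiple of \<open>u\<close> that agrees with
  \<open>w\<close> at \<open>i\<close>. Off the line of \<open>u\<close>, some \<open>j\<close>
  makes this difference nonzero.\<close>

lemma dotp_separates:
  fixes u w :: "'a::field ^ 'n::finite"
  assumes "u \<noteq> 0" "w \<notin> range (\<lambda>c. c *s u)"
  obtains e where "dotp e u = 0" "dotp e w \<noteq> 0"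
proof -
  from assms(1) obtain i where i: "u $ i \<noteq> 0" by (auto simp: vec_eq_iff)
  have "w \<noteq> (w $ i / u $ i) *s u" using assms(2) by blast
  then obtain j where j: "w $ j \<noteq> (w $ i / u $ i) * u $ j" by (auto simp: vec_eq_iff)
  define e where "e = axis j 1 + axis i (- (u $ j / u $ i))"
  have "dotp e u = 0" "dotp e w \<noteq> 0"
    using i j by (auto simp: e_def dotp_add_left dotp_axis field_simps)
  then show thesis by (rule that)
qed

lemma dotp_nondegenerate:
  fixes u :: "'a::field ^ 'n::finite"
  assumes "u \<noteq> 0"
  obtains e where "dotp e u \<noteq> 0"
  using assms by (metis (no_types) dotp_axis mult_1 vec_eq_iff zero_index)

text \<open>Splitting off the component along \<open>e\<close> identifies \<open>S\<close> with the
  product of the field and the zero level. Keeping \<open>S\<close> general allows a second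
  application inside a hyperplane.\<close>

lemma card_level_set:
  fixes S :: "('a::{field,finite} ^ 'n::finite) set"
  assumes S: "\<And>y c. y \<in> S \<Longrightarrow> y + c *s e \<in> S" and e: "dotp e u \<noteq> 0"
  shows "card S = CARD('a) * card {y \<in> S. dotp y u = 0}"
proof -
  have S': "y - c *s e \<in> S" if "y \<in> S" for y c
    using S[OF that, of "- c"] by simp
  have "bij_betw (\<lambda>(c, y). y + c *s e) (UNIV \<times> {y \<in> S. dotp y u = 0}) S"
  proof (rule bij_betwI[where g = "\<lambda>y. (dotp y u / dotp e u, y - (dotp y u / dotp e u) *s e)"])
    show "(\<lambda>(c, y). y + c *s e) \<in> UNIV \<times> {y \<in> S. dotp y u = 0} \<rightarrow> S"
      by (auto intro: S)
    show "(\<lambda>y. (dotp y u / dotp e u, y - (dotp y u / dotp e u) *s e)) \<in> S \<rightarrow> UNIV \<times> {y \<in> S. dotp y u = 0}"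
      using e by (auto intro: S' simp: dotp_diff_left dotp_scale_left)
  qed (use e in \<open>auto simp: dotp_add_left dotp_scale_left\<close>)
  from bij_betw_same_card[OF this] show ?thesis by (simp add: card_cartesian_product)
qed

text \<open>The product form avoids truncated subtraction in the exponent.\<close>

lemma card_hyperplane:
  fixes u :: "'a::{field,finite} ^ 'n::finite"
  assumes "u \<noteq> 0"
  shows "CARD('a) * card {y. dotp y u = 0} = CARD('a) ^ CARD('n)"
proof -
  obtain e where "dotp e u \<noteq> 0" using assms by (rule dotp_nondegenerate)
  then show ?thesis using card_level_set[of UNIV e u] by simp
qed

lemma card_codim_2:
  fixes u w :: "'a::{field,finite} ^ 'n::finite"
  assumes "u \<noteq> 0" "w \<notin> range (\<lambda>c. c *s u)"
  shows "CARD('a)\<^sup>2 * card {y. dotp y u = 0 \<and> dotp y w = 0} = CARD('a) ^ CARD('n)"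
proof -
  obtain e where "dotp e u = 0" "dotp e w \<noteq> 0" using assms by (rule dotp_separates)
  then have "card {y. dotp y u = 0} = CARD('a) * card {y \<in> {y. dotp y u = 0}. dotp y w = 0}"
    by (intro card_level_set) (auto simp: dotp_add_left dotp_scale_left)
  then show ?thesis using card_hyperplane[OF assms(1)] by (simp add: power2_eq_square mult.assoc)
qed

section \<open>Sums of scale-invariant functions over lines and hyperplanes\<close>

text \<open>A function on projective points is represented by a scale-invariant function on vectors
  that vanishes at 0; each point then has \<open>CARD('a) - 1\<close> representatives.\<close>

lemma sum_line:
  fixes a :: "'a::{field,finite} ^ 'n::finite \<Rightarrow> real"
  assumes u: "u \<noteq> 0" and a0: "a 0 = 0" and ac: "\<And>c w. c \<noteq> 0 \<Longrightarrow> a (c *s w) = a w"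
  shows "(\<Sum>w\<in>range (\<lambda>c. c *s u). a w) = (real CARD('a) - 1) * a u"
proof -
  have "inj (\<lambda>c. c *s u)" using u by (auto simp: inj_def vec_eq_iff)
  then have "(\<Sum>w\<in>range (\<lambda>c. c *s u). a w) = (\<Sum>c\<in>UNIV. a (c *s u))"
    by (simp add: sum.reindex)
  also have "\<dots> = a (0 *s u) + (\<Sum>c\<in>UNIV - {0}. a (c *s u))"
    by (rule sum.remove) auto
  also have "\<dots> = (\<Sum>c\<in>UNIV - {0::'a}. a u)" using a0 by (simp add: ac)
  also have "\<dots> = (real CARD('a) - 1) * a u"
    by (simp add: card_Diff_subset of_nat_diff Suc_leI)
  finally show ?thesis .
qed

text \<open>Double counting: a nonzero \<open>u\<close> is orthogonal to exactly \<open>R\<close>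
  vectors \<open>y\<close>, zero included, and \<open>u = 0\<close> contributes nothing.\<close>

lemma sum_hyperplanes:
  fixes a :: "'a::{field,finite} ^ 'n::finite \<Rightarrow> real"
  assumes "a 0 = 0" "R * real CARD('a) = real CARD('a) ^ CARD('n)"
  shows "(\<Sum>y\<in>UNIV. \<Sum>u | dotp y u = 0. a u) = R * (\<Sum>u\<in>UNIV. a u)"
proof -
  have "(\<Sum>y\<in>UNIV. \<Sum>u | dotp y u = 0. a u) = (\<Sum>u\<in>UNIV. \<Sum>y | dotp y u = 0. a u)"
    using sum.swap_restrict[of UNIV UNIV "\<lambda>y u. a u" "\<lambda>y u. dotp y u = 0"] by simp
  also have "\<dots> = (\<Sum>u\<in>UNIV. R * a u)"
  proof (rule sum.cong)
    fix u :: "'a ^ 'n"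
    show "(\<Sum>y | dotp y u = 0. a u) = R * a u"
    proof (cases "u = 0")
      case False
      have "real CARD('a) * real (card {y. dotp y u = 0}) = real CARD('a) * R"
        using arg_cong[OF card_hyperplane[OF False], of real] by (simp add: assms(2)[symmetric])
      then have "real (card {y. dotp y u = 0}) = R" by (subst (asm) mult_cancel_left) simp
      then show ?thesis by simp
    qed (simp add: assms)
  qed simp
  finally show ?thesis by (simp add: sum_distrib_left)
qed

text \<open>Two independent vectors lie in \<open>r\<close> common hyperplanes and two proportional ones in \<open>q r\<close>;
  the zero normal vector is included in the sum.\<close>

lemma sum_hyperplanes_square:
  fixes a :: "'a::{field,finite} ^ 'n::finite \<Rightarrow> real"
  assumes a0: "a 0 = 0" and ac: "\<And>c w. c \<noteq> 0 \<Longrightarrow> a (c *s w) = a w"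
    and r: "r * (real CARD('a))\<^sup>2 = real CARD('a) ^ CARD('n)"
  shows "(\<Sum>y\<in>UNIV. (\<Sum>u | dotp y u = 0. a u)\<^sup>2) =
    r * ((\<Sum>u\<in>UNIV. a u)\<^sup>2 + (real CARD('a) - 1)\<^sup>2 * (\<Sum>u\<in>UNIV. (a u)\<^sup>2))"
proof -
  let ?q = "real CARD('a)"
  define C where "C u w = real (card {y. dotp y u = 0 \<and> dotp y w = 0})" for u w :: "'a ^ 'n"
  \<comment> \<open>One row of the quadratic form. The coefficient \<open>C u w\<close> is
    \<open>r\<close> off the line of \<open>u\<close> and exceeds \<open>r\<close> by
    \<open>(?q - 1) * r\<close> on it; summing this excess by \<open>sum_line\<close> brings the
    second factor \<open>?q - 1\<close>.\<close>
  have inner: "(\<Sum>w\<in>UNIV. C u w * (a u * a w)) = r * (a u * (\<Sum>w\<in>UNIV. a w) + (?q - 1)\<^sup>2 * (a u)\<^sup>2)" for u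
  proof (cases "u = 0")
    case False
    let ?X = "range (\<lambda>c. c *s u)"
    have q: "?q > 0" by simp
    have inX: "C u w = ?q * r" if w: "w \<in> ?X" for w
    proof -
      have "{y. dotp y u = 0 \<and> dotp y w = 0} = {y. dotp y u = 0}"
        using w by (auto simp: dotp_scale_right)
      moreover have "?q * real (card {y. dotp y u = 0}) = ?q * (?q * r)"
      proof -
        have "?q * real (card {y. dotp y u = 0}) = ?q ^ CARD('n)"
          using arg_cong[OF card_hyperplane[OF False], of real] by simp
        then show ?thesis by (simp add: r[symmetric] power2_eq_square)
      qed
      ultimately show ?thesis by (simp add: C_def)
    qed
    have notinX: "C u w = r" if w: "w \<notin> ?X" for w
    proof -
      have "?q\<^sup>2 * C u w = ?q ^ CARD('n)"
        using arg_cong[OF card_codim_2[OF False w], of real] by (simp add: C_def)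
      then have "?q\<^sup>2 * C u w = ?q\<^sup>2 * r" by (simp add: r[symmetric])
      then show ?thesis by (subst (asm) mult_cancel_left) simp
    qed
    have "(\<Sum>w\<in>UNIV. C u w * (a u * a w)) =
        (\<Sum>w\<in>UNIV. r * (a u * a w)) + (\<Sum>w\<in>?X. (?q - 1) * r * (a u * a w))"
    proof -
      have "C u w * (a u * a w) = r * (a u * a w) + (if w \<in> ?X then (?q - 1) * r * (a u * a w) else 0)" for w
        by (cases "w \<in> ?X") (simp_all only: inX notinX if_True if_False not_False_eq_True, simp_all add: algebra_simps)
      moreover have "(\<Sum>w\<in>UNIV. if w \<in> ?X then g w else 0) = sum g ?X" for g :: "'a ^ 'n \<Rightarrow> real"
        by (subst sum.inter_restrict[symmetric]) simp_all
      ultimately show ?thesis by (simp only: sum.distrib)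
    qed
    also have "(\<Sum>w\<in>?X. (?q - 1) * r * (a u * a w)) = (?q - 1) * r * a u * (\<Sum>w\<in>?X. a w)"
      by (simp add: sum_distrib_left mult.assoc)
    also have "\<dots> = (?q - 1) * r * a u * ((?q - 1) * a u)"
      using sum_line[of u a, OF False a0 ac] by simp
    also have "(\<Sum>w\<in>UNIV. r * (a u * a w)) = r * (a u * (\<Sum>w\<in>UNIV. a w))"
      by (simp add: sum_distrib_left)
    finally show ?thesis by (simp add: algebra_simps power2_eq_square)
  qed (simp add: a0)
  have "(\<Sum>y\<in>UNIV. (\<Sum>u | dotp y u = 0. a u)\<^sup>2) =
      (\<Sum>y\<in>UNIV. \<Sum>u\<in>UNIV. \<Sum>w\<in>UNIV. if dotp y u = 0 \<and> dotp y w = 0 then a u * a w else 0)"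
  proof (rule sum.cong)
    fix y :: "'a ^ 'n"
    have "(\<Sum>u | dotp y u = 0. a u) = (\<Sum>u\<in>UNIV. if dotp y u = 0 then a u else 0)"
      by (simp add: sum.If_cases)
    then show "(\<Sum>u | dotp y u = 0. a u)\<^sup>2 =
        (\<Sum>u\<in>UNIV. \<Sum>w\<in>UNIV. if dotp y u = 0 \<and> dotp y w = 0 then a u * a w else 0)"
      by (simp only: power2_eq_square sum_product) (intro sum.cong refl, auto)
  qed simp
  also have "\<dots> = (\<Sum>u\<in>UNIV. \<Sum>w\<in>UNIV. \<Sum>y\<in>UNIV. if dotp y u = 0 \<and> dotp y w = 0 then a u * a w else 0)"
    by (subst sum.swap, rule sum.cong, simp, rule sum.swap)
  also have "\<dots> = (\<Sum>u\<in>UNIV. \<Sum>w\<in>UNIV. C u w * (a u * a w))"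
    by (simp add: C_def sum.If_cases)
  also have "\<dots> = (\<Sum>u\<in>UNIV. r * (a u * (\<Sum>w\<in>UNIV. a w) + (?q - 1)\<^sup>2 * (a u)\<^sup>2))"
    by (simp only: inner)
  also have "\<dots> = r * ((\<Sum>u\<in>UNIV. a u)\<^sup>2 + (?q - 1)\<^sup>2 * (\<Sum>u\<in>UNIV. (a u)\<^sup>2))"
    by (simp add: sum.distrib sum_distrib_left[symmetric] sum_distrib_right[symmetric] power2_eq_square)
  finally show ?thesis .
qed

section \<open>Averaging over rank-one translations\<close>

lemma sum_affine_reindex:
  fixes K :: "'a::{field,finite} ^ 'l::finite \<Rightarrow> real"
  assumes "d \<noteq> 0"
  shows "(\<Sum>w\<in>UNIV. K (z + d *s w)) = (\<Sum>w\<in>UNIV. K w)"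
  by (rule sum.reindex_bij_witness[where i = "\<lambda>w. inverse d *s (w - z)" and j = "\<lambda>w. z + d *s w"])
    (use assms in \<open>auto simp: vector_smult_assoc\<close>)

text \<open>Translation by \<open>outer w y\<close> permutes \<open>S\<close> and moves
  \<open>A *v u\<close> by \<open>dotp y u *s w\<close>. Averaging over all \<open>w\<close> lets
  the argument of \<open>K\<close> run once through the whole space, where \<open>K\<close> has sum
  zero.\<close>

lemma sum_translation_invariant_eq_0:
  fixes K :: "'a::{field,finite} ^ 'l::finite \<Rightarrow> real" and S :: "('a ^ 'n::finite ^ 'l) set"
  assumes S: "\<And>A w. A \<in> S \<Longrightarrow> A + outer w y \<in> S"
    and d: "dotp y u \<noteq> 0" and K: "(\<Sum>v\<in>UNIV. K v) = 0"
  shows "(\<Sum>A\<in>S. K (A *v u)) = 0"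
proof -
  have shift: "(\<Sum>A\<in>S. K (A *v u)) = (\<Sum>A\<in>S. K (A *v u + dotp y u *s w))" for w
  proof -
    have neg: "outer (- w) y = - outer w y" by (simp add: outer_def vec_eq_iff)
    have inv: "A - outer w y \<in> S" if "A \<in> S" for A
      using S[OF that, of "- w"] by (simp add: neg)
    show ?thesis
      by (rule sum.reindex_bij_witness[where i = "\<lambda>A. A + outer w y" and j = "\<lambda>A. A - outer w y"])
        (use S inv in \<open>auto simp: matrix_vector_mult_diff_rdistrib outer_mult_vec\<close>)
  qed
  have "real CARD('a ^ 'l) * (\<Sum>A\<in>S. K (A *v u)) = (\<Sum>w\<in>(UNIV :: ('a ^ 'l) set). \<Sum>A\<in>S. K (A *v u))"
    by simp
  also have "\<dots> = (\<Sum>w\<in>UNIV. \<Sum>A\<in>S. K (A *v u + dotp y u *s w))"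
    by (intro sum.cong shift refl)
  also have "\<dots> = (\<Sum>A\<in>S. \<Sum>w\<in>UNIV. K (A *v u + dotp y u *s w))" by (rule sum.swap)
  also have "\<dots> = 0" by (simp only: sum_affine_reindex[OF d] K sum.neutral_const)
  finally show ?thesis by simp
qed

section \<open>Boolean degree-one functions of matrices\<close>

text \<open>Here \<open>q\<^sup>2 r\<close> is \<open>q\<^sup>n\<close>; the last two assumptions are the sums of \<open>(1 - d) (h q\<^sup>n\<^sup>-\<^sup>1 - d) \<ge> 0\<close> over the
  line densities and of \<open>d (\<epsilon> - d) \<ge> 0\<close> over the pencil densities \<open>d\<close> at a matrix in \<open>L\<close>.\<close>

lemma hyperplane_pencil_contradiction:
  fixes q r h \<epsilon> D :: real
  assumes q: "q \<ge> 2" and r: "r \<ge> 1" and h: "h \<ge> 0" and t: "h * (q\<^sup>2 * r) < 2 / 5"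
    and \<epsilon>: "(q - 1) * \<epsilon> = h * (q\<^sup>2 * r - q)"
    and hyp: "0 \<le> (q\<^sup>2 * r - 1) * ((1 - h) * (h * (q * r) - h))
        - (1 - h + (h * (q * r) - h)) * ((q * r - 1) * (1 - h)) + ((r - 1) * (1 - h)\<^sup>2 + r * D)"
    and pts: "D \<le> (q\<^sup>2 * r - 1) * h * (\<epsilon> - h) + (q - 1) * (\<epsilon> - 2 * h) * (1 - h)"
  shows False
proof -
  define t' where "t' = h * (q\<^sup>2 * r)"
  define K where "K = 1 - h"
  have "4 \<le> q\<^sup>2 * r"
    using mult_mono[of 4 "q\<^sup>2" 1 r] power_mono[OF q, of 2] r by simp
  then have "h * 4 \<le> t'" unfolding t'_def by (intro mult_left_mono h)
  then have h10: "h < 1 / 10" and t2: "t' < 2 / 5" using t by (auto simp: t'_def)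
  have qr: "q \<le> q\<^sup>2 * r" using mult_mono[of q "q * q" 1 r] q r by (simp add: power2_eq_square)
  have e0: "\<epsilon> \<ge> 0"
  proof -
    have "(q - 1) * \<epsilon> \<ge> 0" unfolding \<epsilon> using h qr by simp
    then show ?thesis using q by (simp add: zero_le_mult_iff)
  qed
  have e1: "\<epsilon> \<le> t'"
  proof -
    have "1 * \<epsilon> \<le> (q - 1) * \<epsilon>" using q e0 by (intro mult_right_mono) auto
    also have "\<dots> \<le> t'" using h q unfolding \<epsilon> t'_def by (simp add: right_diff_distrib)
    finally show ?thesis by simp
  qed
  \<comment> \<open>This makes the upper bound \<open>pts\<close> divisible by \<open>q - 1\<close>,
    like the lower bound that follows.\<close>
  have N: "(q\<^sup>2 * r - 1) * h = (q - 1) * (\<epsilon> + h)" using \<epsilon> by (simp add: algebra_simps)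
  \<comment> \<open>The terms of \<open>hyp\<close> other than \<open>r * D\<close> combine to a
    multiple of \<open>r * (q - 1) * K\<close>.\<close>
  have "r * ((q - 1) * (K * (K - (t' - h * q)))) \<le> r * D"
    using hyp unfolding K_def t'_def by (simp add: algebra_simps power2_eq_square)
  then have "(q - 1) * (K * (K - (t' - h * q))) \<le> D" using r by simp
  also have "\<dots> \<le> (q - 1) * ((\<epsilon> + h) * (\<epsilon> - h) + (\<epsilon> - 2 * h) * K)"
    using pts unfolding N K_def by (simp add: algebra_simps)
  finally have "K * (K - (t' - h * q)) \<le> (\<epsilon> + h) * (\<epsilon> - h) + (\<epsilon> - 2 * h) * K"
    using q by simp
  then have "K * (1 - t' - \<epsilon> + h * (q + 1)) \<le> \<epsilon>\<^sup>2 - h\<^sup>2"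
    by (simp add: K_def algebra_simps power2_eq_square)
  \<comment> \<open>The left side is at least 0.18 and the right side at most 0.16. The threshold
    2/5 for \<open>t'\<close> is chosen so that these bounds are incompatible.\<close>
  moreover have "(9 / 10) * (1 / 5) \<le> K * (1 - t' - \<epsilon> + h * (q + 1))"
  proof (rule mult_mono)
    have "0 \<le> h * (q + 1)" using h q by simp
    then show "1 / 5 \<le> 1 - t' - \<epsilon> + h * (q + 1)" using t2 e1 by linarith
  qed (use h10 in \<open>auto simp: K_def\<close>)
  moreover have "\<epsilon>\<^sup>2 \<le> (2 / 5)\<^sup>2" using e0 e1 t2 by (intro power_mono) auto
  then have "\<epsilon>\<^sup>2 \<le> 4 / 25" by (simp add: power2_eq_square)
  moreover have "0 \<le> h\<^sup>2" by simp
  ultimately show False by linarith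
qed

lemma ex_matrix_mult_eq:
  fixes u :: "'a::field ^ 'n::finite" and v :: "'a ^ 'l::finite"
  assumes "u \<noteq> 0"
  shows "\<exists>A. A *v u = v"
proof -
  obtain y where "dotp y u \<noteq> 0" using assms by (rule dotp_nondegenerate)
  then have "outer (inverse (dotp y u) *s v) y *v u = v"
    by (simp add: outer_mult_vec vector_smult_assoc)
  then show ?thesis ..
qed

text \<open>A matrix with the right value at \<open>u\<close> is corrected at \<open>w\<close> by a
  rank-one matrix that vanishes at \<open>u\<close>.\<close>

lemma ex_matrix_mult_eq2:
  fixes u w :: "'a::field ^ 'n::finite" and v z :: "'a ^ 'l::finite"
  assumes "u \<noteq> 0" "w \<notin> range (\<lambda>c. c *s u)"
  shows "\<exists>A. A *v u = v \<and> A *v w = z"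
proof -
  obtain A where A: "A *v u = v" using ex_matrix_mult_eq[OF assms(1)] by blast
  obtain y where y: "dotp y u = 0" "dotp y w \<noteq> 0" using assms by (rule dotp_separates)
  have "(A + outer (inverse (dotp y w) *s (z - A *v w)) y) *v u = v"
    "(A + outer (inverse (dotp y w) *s (z - A *v w)) y) *v w = z"
    using A y by (simp_all add: add_outer_mult_vec vector_smult_assoc)
  then show ?thesis by blast
qed

text \<open>
  The functions \<open>k u\<close> form the centred degree-one part of the indicator of \<open>L\<close>, and \<open>h\<close> is the density
  of \<open>L\<close>. Summation over all \<open>u\<close> counts every projective point \<open>q - 1\<close> times.
\<close>

locale boolean_degree_one =
  fixes L :: "('a::{field,finite} ^ 'n::finite ^ 'l::finite) set"
    and k :: "'a ^ 'n \<Rightarrow> 'a ^ 'l \<Rightarrow> real" and h q :: real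
  assumes q_eq: "q = real CARD('a)"
    and sum_k: "u \<noteq> 0 \<Longrightarrow> (\<Sum>v\<in>UNIV. k u v) = 0"
    and k_scale: "c \<noteq> 0 \<Longrightarrow> k (c *s u) (c *s v) = k u v"
    and k_zero: "k 0 v = 0"
    and indicator_eq: "indicator L A = h + (\<Sum>u\<in>UNIV. k u (A *v u))"
begin

text \<open>The proportion of \<open>L\<close> among the matrices \<open>A + outer v y\<close>,
  given directly by the terms that survive the averaging; \<open>sum_indicator_line\<close>
  justifies this reading.\<close>

definition line_density :: "'a ^ 'n ^ 'l \<Rightarrow> 'a ^ 'n \<Rightarrow> real" where
  "line_density A y = h + (\<Sum>u | dotp y u = 0. k u (A *v u))"

text \<open>For \<open>u \<noteq> 0\<close>, the proportion of \<open>L\<close> in the pencil of all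
  \<open>A\<close> with \<open>A *v u = v\<close>. The factor \<open>q - 1\<close> counts the
  nonzero multiples of \<open>u\<close>.\<close>

definition pencil_density :: "'a ^ 'n \<Rightarrow> 'a ^ 'l \<Rightarrow> real" where
  "pencil_density u v = h + (q - 1) * k u v"

definition full :: "'a ^ 'n \<Rightarrow> 'a ^ 'l \<Rightarrow> bool" where
  "full u v \<longleftrightarrow> {A. A *v u = v} \<subseteq> L"

lemma k_mult_scale: "c \<noteq> 0 \<Longrightarrow> k (c *s u) (A *v (c *s u)) = k u (A *v u)"
  by (simp add: vec.scale k_scale)

lemma sum_k_mult: "(\<Sum>u\<in>UNIV. k u (A *v u)) = indicator L A - h"
  using indicator_eq[of A] by simp

text \<open>Each term \<open>k u (A *v u)\<close> has sum zero over all matrices, so only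
  \<open>h\<close> remains.\<close>

lemma card_eq: "real (card L) = h * real CARD('a ^ 'n ^ 'l)"
proof -
  have "(\<Sum>A\<in>UNIV. k u (A *v u)) = 0" for u
  proof (cases "u = 0")
    case False
    then obtain y where "dotp y u \<noteq> 0" by (rule dotp_nondegenerate)
    then show ?thesis using sum_translation_invariant_eq_0[of UNIV y u "k u"] sum_k[OF False] by simp
  qed (simp add: k_zero)
  moreover have "real (card L) = (\<Sum>A\<in>(UNIV :: ('a ^ 'n ^ 'l) set). indicator L A)" by (simp add: indicator_def sum.If_cases)
  moreover have "\<dots> = (\<Sum>A\<in>(UNIV :: ('a ^ 'n ^ 'l) set). h) + (\<Sum>u\<in>UNIV. \<Sum>A\<in>UNIV. k u (A *v u))"
    by (simp only: indicator_eq sum.distrib) (subst sum.swap, simp)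
  ultimately show ?thesis by simp
qed

lemma h_nonneg: "0 \<le> h"
proof -
  have "0 \<le> h * real CARD('a ^ 'n ^ 'l)" by (simp only: card_eq[symmetric] of_nat_0_le_iff)
  moreover have "0 < real CARD('a ^ 'n ^ 'l)" by (simp only: of_nat_0_less_iff) simp
  ultimately show ?thesis by (simp only: zero_le_mult_iff) linarith
qed

section \<open>Densities on lines\<close>

text \<open>A term with \<open>dotp y u = 0\<close> is constant along the line; any other runs
  through all values of \<open>k u\<close> and cancels.\<close>

lemma sum_indicator_line:
  "(\<Sum>v\<in>UNIV. indicator L (A + outer v y)) = real CARD('a ^ 'l) * line_density A y"
proof -
  have "(\<Sum>v\<in>UNIV. k u ((A + outer v y) *v u)) =
      real CARD('a ^ 'l) * (if dotp y u = 0 then k u (A *v u) else 0)" for u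
  proof (cases "dotp y u = 0")
    case False
    then have "u \<noteq> 0" by auto
    with False show ?thesis by (simp add: add_outer_mult_vec sum_affine_reindex sum_k)
  qed (simp add: add_outer_mult_vec)
  then have "(\<Sum>u\<in>UNIV. \<Sum>v\<in>UNIV. k u ((A + outer v y) *v u)) =
      real CARD('a ^ 'l) * (\<Sum>u | dotp y u = 0. k u (A *v u))"
    by (simp only: sum_distrib_left[symmetric]) (simp add: sum.If_cases)
  then show ?thesis
    by (simp only: indicator_eq sum.distrib line_density_def distrib_left)
      (subst sum.swap, simp)
qed

lemma card_vec_pos: "0 < real CARD('a ^ 'l)"
  by (simp only: of_nat_0_less_iff) simp

lemma line_density_bounds: "0 \<le> line_density A y" "line_density A y \<le> 1"
proof -
  have "0 \<le> (\<Sum>v\<in>UNIV. indicator L (A + outer v y) :: real)" by (simp add: sum_nonneg)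
  then show "0 \<le> line_density A y"
    using card_vec_pos by (simp only: sum_indicator_line zero_le_mult_iff) linarith
  have "(\<Sum>v\<in>UNIV. indicator L (A + outer v y)) \<le> (\<Sum>v\<in>(UNIV :: ('a ^ 'l) set). 1 :: real)"
    by (intro sum_mono) (simp add: indicator_def)
  then have "real CARD('a ^ 'l) * line_density A y \<le> real CARD('a ^ 'l) * 1"
    by (simp only: sum_indicator_line) simp
  then show "line_density A y \<le> 1" using card_vec_pos by (simp only: mult_le_cancel_left_pos)
qed

lemma line_density_add_outer: "line_density (A + outer v y) y = line_density A y"
  unfolding line_density_def by (intro arg_cong2[where f = "(+)"] sum.cong refl) (simp add: add_outer_mult_vec)

lemma line_density_scale: "c \<noteq> 0 \<Longrightarrow> line_density A (c *s y) = line_density A y"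
  by (simp add: line_density_def dotp_scale_left)

lemma line_density_zero: "line_density A 0 = indicator L A"
  by (simp add: line_density_def indicator_eq)

text \<open>The vector 0 is left out because its line is just \<open>A\<close>. For \<open>A\<close>
  outside \<open>L\<close> the sum is \<open>(q - 1) * (h * R)\<close>.\<close>

lemma sum_line_density:
  assumes "R * q = q ^ CARD('n)"
  shows "(\<Sum>y\<in>UNIV - {0}. line_density A y) = (q ^ CARD('n) - 1) * h + (R - 1) * (indicator L A - h)"
proof -
  have "(\<Sum>y\<in>UNIV. line_density A y) = q ^ CARD('n) * h + R * (indicator L A - h)"
    using sum_hyperplanes[where a = "\<lambda>u. k u (A *v u)", OF _ assms[unfolded q_eq]]
    by (simp add: line_density_def sum.distrib k_zero sum_k_mult q_eq)
  moreover have "(\<Sum>y\<in>UNIV. line_density A y) = line_density A 0 + (\<Sum>y\<in>UNIV - {0}. line_density A y)"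
    by (rule sum.remove) auto
  ultimately show ?thesis by (simp add: line_density_zero algebra_simps)
qed

text \<open>The \<open>q - 1\<close> nonzero multiples of \<open>u\<close> each contribute
  \<open>b u\<close>.\<close>

lemma sum_scale_class_le:
  fixes b :: "'a ^ 'm::finite \<Rightarrow> real"
  assumes "u \<noteq> 0" "\<And>c w. c \<noteq> 0 \<Longrightarrow> b (c *s w) = b w" "\<And>w. w \<noteq> 0 \<Longrightarrow> 0 \<le> b w"
  shows "(q - 1) * b u \<le> (\<Sum>w\<in>UNIV - {0}. b w)"
proof -
  let ?b = "\<lambda>w. if w = 0 then 0 else b w"
  have "(q - 1) * ?b u = (\<Sum>w\<in>range (\<lambda>c. c *s u). ?b w)"
    unfolding q_eq by (rule sum_line[symmetric]) (use assms(1,2) in auto)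
  also have "\<dots> \<le> (\<Sum>w\<in>UNIV. ?b w)" by (rule sum_mono2) (use assms(3) in auto)
  also have "\<dots> = (\<Sum>w\<in>UNIV - {0}. b w)" by (simp add: sum.remove[of UNIV 0])
  finally show ?thesis using assms(1) by simp
qed

lemma q_ge_2: "2 \<le> q"
proof -
  have "card {0 :: 'a, 1} \<le> CARD('a)" by (rule card_mono) auto
  then show ?thesis by (simp add: q_eq)
qed

text \<open>A line not contained in \<open>L\<close> has a matrix \<open>?B\<close> outside
  \<open>L\<close>, where all line densities sum to only \<open>(q - 1) * (h * R)\<close>. The
  multiples of \<open>y\<close> alone contribute \<open>q - 1\<close> copies of the density in
  question.\<close>

lemma line_density_dichotomy:
  assumes y: "y \<noteq> 0" and R: "R * q = q ^ CARD('n)"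
  shows "line_density A y = 1 \<or> line_density A y \<le> h * R"
proof (cases "\<forall>v. A + outer v y \<in> L")
  case True
  then have "real CARD('a ^ 'l) * line_density A y = real CARD('a ^ 'l) * 1"
    by (simp only: sum_indicator_line[symmetric]) (simp add: indicator_def)
  then show ?thesis using card_vec_pos by (simp only: mult_cancel_left) auto
next
  case False
  then obtain v where B: "A + outer v y \<notin> L" by auto
  let ?B = "A + outer v y"
  have "(q - 1) * line_density ?B y \<le> (\<Sum>w\<in>UNIV - {0}. line_density ?B w)"
    using sum_scale_class_le[of y "line_density ?B", OF y line_density_scale line_density_bounds(1)] .
  also have "\<dots> = (q - 1) * (h * R)"
    using B by (simp add: sum_line_density[OF R] R[symmetric] algebra_simps)
  finally show ?thesis using q_ge_2 by (simp add: line_density_add_outer)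
qed

section \<open>Densities on pencils\<close>

text \<open>For \<open>w\<close> independent of \<open>u\<close>, some \<open>y\<close> is
  orthogonal to \<open>u\<close> but not to \<open>w\<close>; translations by
  \<open>outer v y\<close> preserve the pencil and cancel the term of \<open>w\<close>. The nonzero
  multiples of \<open>u\<close> each contribute \<open>k u v\<close>.\<close>

lemma sum_indicator_pencil:
  assumes u: "u \<noteq> 0"
  shows "(\<Sum>A | A *v u = v. indicator L A) = real (card {A :: 'a ^ 'n ^ 'l. A *v u = v}) * pencil_density u v"
proof -
  let ?S = "{A :: 'a ^ 'n ^ 'l. A *v u = v}" and ?X = "range (\<lambda>c. c *s u)"
  have out: "(\<Sum>A\<in>?S. k w (A *v w)) = 0" if w: "w \<notin> ?X" for w
  proof -
    obtain y where "dotp y u = 0" "dotp y w \<noteq> 0" using u w by (rule dotp_separates)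
    moreover have "w \<noteq> 0" using w by (metis rangeI vector_smult_lzero)
    ultimately show ?thesis
      using sum_translation_invariant_eq_0[of ?S y w "k w"] sum_k[of w] by (simp add: add_outer_mult_vec)
  qed
  have "(\<Sum>w\<in>UNIV. \<Sum>A\<in>?S. k w (A *v w)) = (\<Sum>w\<in>?X. \<Sum>A\<in>?S. k w (A *v w))"
    by (rule sum.mono_neutral_right) (use out in auto)
  also have "\<dots> = (\<Sum>A\<in>?S. \<Sum>w\<in>?X. k w (A *v w))" by (rule sum.swap)
  also have "\<dots> = (\<Sum>A\<in>?S. (q - 1) * k u v)"
    by (intro sum.cong refl, subst sum_line[OF u]) (auto simp: k_zero k_mult_scale q_eq)
  finally have "(\<Sum>w\<in>UNIV. \<Sum>A\<in>?S. k w (A *v w)) = real (card ?S) * ((q - 1) * k u v)" by simp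
  then show ?thesis
    by (simp only: indicator_eq sum.distrib pencil_density_def distrib_left)
      (subst sum.swap, simp)
qed

lemma card_pencil_pos:
  assumes "u \<noteq> 0"
  shows "0 < real (card {A :: 'a ^ 'n ^ 'l. A *v u = v})"
proof -
  have "{A :: 'a ^ 'n ^ 'l. A *v u = v} \<noteq> {}" using ex_matrix_mult_eq[OF assms, of v] by blast
  then show ?thesis by (simp add: card_gt_0_iff)
qed

lemma pencil_density_nonneg:
  assumes "u \<noteq> 0"
  shows "0 \<le> pencil_density u v"
proof -
  have "0 \<le> (\<Sum>A | A *v u = v. indicator L A :: real)" by (simp add: sum_nonneg)
  then show ?thesis
    using card_pencil_pos[OF assms, of v] by (simp only: sum_indicator_pencil[OF assms] zero_le_mult_iff) linarith
qed

lemma pencil_density_full: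
  assumes "u \<noteq> 0" "full u v"
  shows "pencil_density u v = 1"
proof -
  have "(\<Sum>A | A *v u = v. indicator L A) = (\<Sum>A | A *v u = v. 1 :: real)"
    using assms(2) by (intro sum.cong) (auto simp: full_def)
  then show ?thesis
    using ex_matrix_mult_eq[OF assms(1), of v] by (auto simp: sum_indicator_pencil[OF assms(1)])
qed

lemma pencil_density_scale: "c \<noteq> 0 \<Longrightarrow> pencil_density (c *s u) (A *v (c *s u)) = pencil_density u (A *v u)"
  by (simp add: pencil_density_def k_mult_scale)

text \<open>The sum is \<open>h * (q ^ CARD('n) - q)\<close> for \<open>A\<close> outside
  \<open>L\<close> and larger by \<open>q - 1\<close> for \<open>A\<close> in
  \<open>L\<close>.\<close>

lemma sum_pencil_density:
  "(\<Sum>u\<in>UNIV - {0}. pencil_density u (A *v u)) = (q ^ CARD('n) - 1) * h + (q - 1) * (indicator L A - h)"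
proof -
  have "(\<Sum>u\<in>UNIV - {0}. k u (A *v u)) = indicator L A - h"
    using sum_k_mult[of A] by (simp add: sum.remove[of UNIV 0] k_zero)
  then show ?thesis
    unfolding pencil_density_def
    by (simp add: sum.distrib sum_distrib_left[symmetric] card_Diff_subset of_nat_diff Suc_leI q_eq)
qed

text \<open>As for lines: a pencil not contained in \<open>L\<close> has a member \<open>B\<close>
  outside \<open>L\<close>, where all pencil densities sum to only
  \<open>(q - 1) * \<epsilon>\<close>.\<close>

lemma pencil_density_dichotomy:
  assumes u: "u \<noteq> 0" and \<epsilon>: "(q - 1) * \<epsilon> = h * (q ^ CARD('n) - q)"
  shows "full u v \<or> pencil_density u v \<le> \<epsilon>"
proof (cases "full u v")
  case False
  then obtain B where B: "B *v u = v" "B \<notin> L" by (auto simp: full_def)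
  have "(q - 1) * pencil_density u (B *v u) \<le> (\<Sum>w\<in>UNIV - {0}. pencil_density w (B *v w))"
    by (rule sum_scale_class_le[where b = "\<lambda>u. pencil_density u (B *v u)", OF u])
      (auto simp: pencil_density_scale pencil_density_nonneg)
  also have "\<dots> = (q - 1) * \<epsilon>" using B by (simp add: sum_pencil_density \<epsilon>) (simp add: algebra_simps)
  finally show ?thesis using q_ge_2 B by simp
qed simp

section \<open>Pencils contained in \<open>L\<close>\<close>

text \<open>Otherwise the two pencils share a matrix of \<open>L\<close>. There the multiples of
  \<open>u\<close> and \<open>w\<close> already contribute \<open>2 * (q - 1)\<close>, more than the
  total from \<open>sum_pencil_density\<close>.\<close>

lemma full_point_dependent:
  assumes u: "u \<noteq> 0" "full u v" and w: "w \<noteq> 0" "full w z"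
    and \<epsilon>: "h * (q ^ CARD('n) - q) < q - 1"
  shows "w \<in> range (\<lambda>c. c *s u)"
proof (rule ccontr)
  let ?X = "range (\<lambda>c. c *s u)" and ?Y = "range (\<lambda>c. c *s w)"
  assume nin: "w \<notin> ?X"
  obtain A where A: "A *v u = v" "A *v w = z" using ex_matrix_mult_eq2[OF u(1) nin] by blast
  have AL: "A \<in> L" using u(2) A(1) by (auto simp: full_def)
  let ?b = "\<lambda>u. if u = 0 then 0 else pencil_density u (A *v u)"
  have b: "(\<Sum>w\<in>range (\<lambda>c. c *s u). ?b w) = q - 1" if "u \<noteq> 0" "full u (A *v u)" for u
  proof -
    have "(\<Sum>w\<in>range (\<lambda>c. c *s u). ?b w) = (real CARD('a) - 1) * ?b u"
      by (rule sum_line) (use that in \<open>auto simp: pencil_density_scale\<close>)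
    then show ?thesis using that by (simp add: pencil_density_full) (simp add: q_eq)
  qed
  have "?X \<inter> ?Y = {0}"
  proof -
    have "d *s w = 0" if "c *s u = d *s w" for c d
    proof (rule ccontr)
      assume "d *s w \<noteq> 0"
      then have "d \<noteq> 0" by auto
      then have "w = inverse d *s (d *s w)" by (simp add: vector_smult_assoc)
      also have "\<dots> = (inverse d * c) *s u" by (simp add: that[symmetric] vector_smult_assoc)
      finally show False using nin by blast
    qed
    moreover have "0 \<in> ?X" "0 \<in> ?Y" by (metis rangeI vector_smult_lzero)+
    ultimately show ?thesis by (auto simp del: vec.scale_eq_0_iff)
  qed
  then have "sum ?b (?X \<union> ?Y) = sum ?b ?X + sum ?b ?Y"
    using sum.union_inter[of ?X ?Y ?b] by simp
  also have "\<dots> = 2 * (q - 1)" using b[of u] b[of w] u w A by simp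
  finally have "2 * (q - 1) \<le> sum ?b UNIV"
    using sum_mono2[of UNIV "?X \<union> ?Y" ?b] by (simp add: pencil_density_nonneg)
  also have "\<dots> = (\<Sum>u\<in>UNIV - {0}. pencil_density u (A *v u))" by (simp add: sum.remove[of UNIV 0])
  also have "\<dots> = (q - 1) + h * (q ^ CARD('n) - q)"
    using AL by (simp add: sum_pencil_density) (simp add: algebra_simps)
  finally show False using \<epsilon> by simp
qed

text \<open>If no pencil through \<open>A\<close> is contained in \<open>L\<close>, the dichotomy
  for lines bounds the second moment \<open>D\<close> from below and the one for pencils bounds it
  from above, incompatibly.\<close>

lemma ex_full_point:
  assumes n: "2 \<le> CARD('n)" and t: "h * q ^ CARD('n) < 2 / 5" and A: "A \<in> L"
  shows "\<exists>u. u \<noteq> 0 \<and> full u (A *v u)"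
proof (rule ccontr)
  assume nofull: "\<not> ?thesis"
  define r where "r = q ^ (CARD('n) - 2)"
  define \<epsilon> where "\<epsilon> = h * (q ^ CARD('n) - q) / (q - 1)"
  \<comment> \<open>Since \<open>(q - 1) * k u (A *v u)\<close> is a pencil density minus
    \<open>h\<close>, \<open>D\<close> is the sum of the squared centred pencil densities at
    \<open>A\<close>.\<close>
  define D where "D = (q - 1)\<^sup>2 * (\<Sum>u\<in>UNIV. (k u (A *v u))\<^sup>2)"
  define s where "s y = line_density A y - h" for y
  have N: "q ^ CARD('n) = q\<^sup>2 * r" by (simp only: r_def power_add[symmetric] le_add_diff_inverse[OF n])
  have R: "(q * r) * q = q ^ CARD('n)" using N by (simp add: power2_eq_square)
  have \<epsilon>: "(q - 1) * \<epsilon> = h * (q ^ CARD('n) - q)" using q_ge_2 by (simp add: \<epsilon>_def)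
  have c: "real (card (UNIV - {0 :: 'a ^ 'n})) = q\<^sup>2 * r - 1"
    by (simp add: card_Diff_subset of_nat_diff Suc_leI N[symmetric]) (simp add: q_eq)
  have s1: "(\<Sum>y\<in>UNIV - {0}. s y) = (q * r - 1) * (1 - h)"
  proof -
    have "(\<Sum>y\<in>UNIV - {0}. s y) = (\<Sum>y\<in>UNIV - {0}. line_density A y) - (q\<^sup>2 * r - 1) * h"
      by (simp only: s_def sum_subtractf sum_constant c)
    then show ?thesis using A by (simp add: sum_line_density[OF R] N)
  qed
  \<comment> \<open>The square formula includes \<open>y = 0\<close>, whose term
    \<open>(1 - h)\<^sup>2\<close> is removed.\<close>
  have s2: "(\<Sum>y\<in>UNIV - {0}. (s y)\<^sup>2) = (r - 1) * (1 - h)\<^sup>2 + r * D"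
  proof -
    have "(\<Sum>y\<in>UNIV. (s y)\<^sup>2) = r * ((1 - h)\<^sup>2 + D)"
      using sum_hyperplanes_square[of "\<lambda>u. k u (A *v u)" r] A N
      by (simp add: s_def line_density_def k_zero k_mult_scale sum_k_mult D_def q_eq mult.commute)
    moreover have "(\<Sum>y\<in>UNIV. (s y)\<^sup>2) = (s 0)\<^sup>2 + (\<Sum>y\<in>UNIV - {0}. (s y)\<^sup>2)"
      by (rule sum.remove) auto
    moreover have "s 0 = 1 - h" using A by (simp add: s_def line_density_zero)
    ultimately show ?thesis by (simp add: algebra_simps)
  qed
  have hyp: "0 \<le> (q\<^sup>2 * r - 1) * ((1 - h) * (h * (q * r) - h))
        - (1 - h + (h * (q * r) - h)) * ((q * r - 1) * (1 - h)) + ((r - 1) * (1 - h)\<^sup>2 + r * D)"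
  proof -
    \<comment> \<open>By the dichotomy, either the first factor is zero or both are
      nonnegative.\<close>
    have "0 \<le> (1 - line_density A y) * (h * (q * r) - line_density A y)" if "y \<noteq> 0" for y
      using line_density_dichotomy[OF that R, of A] line_density_bounds(2)[of A y] by auto
    then have "0 \<le> (\<Sum>y\<in>UNIV - {0}. (1 - line_density A y) * (h * (q * r) - line_density A y))"
      by (intro sum_nonneg) simp
    also have "\<dots> = (\<Sum>y\<in>UNIV - {0}. (1 - h) * (h * (q * r) - h)
        - (1 - h + (h * (q * r) - h)) * s y + (s y)\<^sup>2)"
      by (intro sum.cong refl) (simp add: s_def algebra_simps power2_eq_square)
    also have "\<dots> = (\<Sum>y\<in>UNIV - {0 :: 'a ^ 'n}. (1 - h) * (h * (q * r) - h))
        - (1 - h + (h * (q * r) - h)) * (\<Sum>y\<in>UNIV - {0}. s y) + (\<Sum>y\<in>UNIV - {0}. (s y)\<^sup>2)"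
      by (simp only: sum.distrib sum_subtractf sum_distrib_left)
    finally show ?thesis by (simp only: s1 s2 sum_constant c)
  qed
  have pts: "D \<le> (q\<^sup>2 * r - 1) * h * (\<epsilon> - h) + (q - 1) * (\<epsilon> - 2 * h) * (1 - h)"
  proof -
    have "0 \<le> pencil_density u (A *v u) * (\<epsilon> - pencil_density u (A *v u))" if "u \<noteq> 0" for u
      using pencil_density_dichotomy[OF that \<epsilon>, of "A *v u"] nofull that pencil_density_nonneg[OF that]
      by (intro mult_nonneg_nonneg) auto
    then have "0 \<le> (\<Sum>u\<in>UNIV - {0}. pencil_density u (A *v u) * (\<epsilon> - pencil_density u (A *v u)))"
      by (intro sum_nonneg) simp
    also have "\<dots> = (\<Sum>u\<in>UNIV - {0}. h * (\<epsilon> - h) + ((q - 1) * (\<epsilon> - 2 * h)) * k u (A *v u)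
        - (q - 1)\<^sup>2 * (k u (A *v u))\<^sup>2)"
      by (intro sum.cong refl) (simp add: pencil_density_def algebra_simps power2_eq_square)
    also have "\<dots> = (\<Sum>u\<in>UNIV - {0 :: 'a ^ 'n}. h * (\<epsilon> - h))
        + ((q - 1) * (\<epsilon> - 2 * h)) * (\<Sum>u\<in>UNIV - {0}. k u (A *v u))
        - (q - 1)\<^sup>2 * (\<Sum>u\<in>UNIV - {0}. (k u (A *v u))\<^sup>2)"
      by (simp only: sum.distrib sum_subtractf sum_distrib_left)
    also have "(\<Sum>u\<in>UNIV - {0}. k u (A *v u)) = 1 - h"
      using sum_k_mult[of A] A by (simp add: sum.remove[of UNIV 0] k_zero)
    also have "(q - 1)\<^sup>2 * (\<Sum>u\<in>UNIV - {0}. (k u (A *v u))\<^sup>2) = D"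
      by (simp add: D_def sum.remove[of UNIV 0] k_zero)
    finally show ?thesis by (simp only: sum_constant c)
  qed
  have "1 \<le> r" using q_ge_2 by (simp add: r_def)
  from hyperplane_pencil_contradiction[OF q_ge_2 this h_nonneg _ _ hyp pts] t \<epsilon>
  show False by (simp add: N)
qed

text \<open>Each member of \<open>L\<close> lies in a contained pencil, and all of these share one
  direction \<open>u\<close>, so \<open>V\<close> can be the set of all \<open>v\<close> with
  \<open>full u v\<close>. The empty \<open>L\<close> is covered by an empty
  \<open>V\<close>.\<close>

lemma pencil_union:
  assumes n: "2 \<le> CARD('n)" and t: "h * q ^ CARD('n) < 2 / 5"
  shows "\<exists>u V. u \<noteq> 0 \<and> L = {A. A *v u \<in> V}"
proof (cases "L = {}")
  case True
  have "axis undefined 1 \<noteq> (0 :: 'a ^ 'n)" by (simp add: axis_eq_0_iff)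
  then show ?thesis using True by blast
next
  case False
  then obtain A0 where "A0 \<in> L" by blast
  then obtain u where u: "u \<noteq> 0" "full u (A0 *v u)" using ex_full_point[OF n t] by blast
  have \<epsilon>: "h * (q ^ CARD('n) - q) < q - 1"
  proof -
    have "h * (q ^ CARD('n) - q) \<le> h * q ^ CARD('n)" using h_nonneg q_ge_2 by (intro mult_left_mono) auto
    then show ?thesis using t q_ge_2 by linarith
  qed
  have "full u (A *v u)" if AL: "A \<in> L" for A
  proof -
    obtain w where w: "w \<noteq> 0" "full w (A *v w)" using ex_full_point[OF n t AL] by blast
    obtain c where c: "w = c *s u" using full_point_dependent[OF u w \<epsilon>] by blast
    with w have "c \<noteq> 0" by auto
    \<comment> \<open>Multiplying the equation by \<open>c\<close> does not change the
      pencil.\<close>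
    then show ?thesis using w(2) by (auto simp: full_def c vec.scale)
  qed
  then have "L = {A. A *v u \<in> {v. full u v}}" by (auto simp: full_def)
  with u show ?thesis by blast
qed

end

section \<open>Centring the coefficients and counting pencils\<close>

text \<open>Each \<open>g u\<close> is replaced by its deviation from its mean \<open>m u\<close>,
  and the means add up to \<open>h\<close>. The mean is scale invariant because multiplication by
  \<open>c\<close> permutes the vectors \<open>v\<close>.\<close>

lemma boolean_degree_one_centre:
  fixes L :: "('a::{field,finite} ^ 'n::finite ^ 'l::finite) set" and g :: "'a ^ 'n \<Rightarrow> 'a ^ 'l \<Rightarrow> real"
  assumes g_scale: "\<And>c u v. c \<noteq> 0 \<Longrightarrow> g (c *s u) (c *s v) = g u v"
    and g_zero: "\<And>v. g 0 v = 0"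
    and g: "\<And>A. indicator L A = (\<Sum>u\<in>UNIV. g u (A *v u))"
  shows "\<exists>k h. boolean_degree_one L k h (real CARD('a))"
proof -
  define m where "m u = (\<Sum>v\<in>UNIV. g u v) / real CARD('a ^ 'l)" for u
  have "boolean_degree_one L (\<lambda>u v. g u v - m u) (\<Sum>u\<in>UNIV. m u) (real CARD('a))"
  proof
    fix u :: "'a ^ 'n"
    show "(\<Sum>v\<in>UNIV. g u v - m u) = 0" by (simp add: sum_subtractf m_def)
  next
    fix c :: 'a and u :: "'a ^ 'n" and v :: "'a ^ 'l"
    assume c: "c \<noteq> 0"
    have "(\<Sum>v\<in>UNIV. g (c *s u) v) = (\<Sum>v\<in>UNIV. g u v)"
      using sum_affine_reindex[OF c, of "g (c *s u)" 0] by (simp add: g_scale[OF c])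
    then show "g (c *s u) (c *s v) - m (c *s u) = g u v - m u"
      by (simp add: m_def g_scale[OF c])
  next
    fix v :: "'a ^ 'l"
    show "g 0 v - m 0 = 0" by (simp add: m_def g_zero)
  next
    fix A :: "'a ^ 'n ^ 'l"
    show "indicator L A = (\<Sum>u\<in>UNIV. m u) + (\<Sum>u\<in>UNIV. g u (A *v u) - m u)"
      by (simp add: g sum_subtractf)
  qed simp
  then show ?thesis by blast
qed

text \<open>The pencils with a given \<open>u\<close> are translates of each other and partition all
  matrices.\<close>

lemma card_pencil:
  fixes u :: "'a::{field,finite} ^ 'n::finite" and v :: "'a ^ 'l::finite"
  assumes "u \<noteq> 0"
  shows "card {A. A *v u = v} * CARD('a) ^ CARD('l) = CARD('a) ^ (CARD('n) * CARD('l))"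
proof -
  have eq: "card {A. A *v u = w} = card {A. A *v u = v}" for w :: "'a ^ 'l"
  proof -
    obtain B where B: "B *v u = v - w" using ex_matrix_mult_eq[OF assms] by blast
    have "bij_betw (\<lambda>A. A + B) {A. A *v u = w} {A. A *v u = v}"
      by (rule bij_betwI[where g = "\<lambda>A. A - B"])
        (use B in \<open>auto simp: matrix_vector_mult_add_rdistrib matrix_vector_mult_diff_rdistrib\<close>)
    then show ?thesis by (rule bij_betw_same_card)
  qed
  have "CARD('a ^ 'n ^ 'l) = (\<Sum>w\<in>UNIV. card {A \<in> (UNIV :: ('a ^ 'n ^ 'l) set). A *v u = w})"
    using sum.group[of UNIV UNIV "\<lambda>A :: 'a ^ 'n ^ 'l. A *v u" "\<lambda>_. 1 :: nat"] by simp
  also have "\<dots> = (\<Sum>w\<in>(UNIV :: ('a ^ 'l) set). card {A. A *v u = v})"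
    using eq by (intro sum.cong) auto
  finally show ?thesis by (simp add: power_mult[symmetric] mult.commute)
qed

section \<open>Vertices of the bilinear forms graph as graphs of matrices\<close>

definition left_part :: "'a ^ ('n::finite + 'l::finite) \<Rightarrow> 'a ^ 'n" where
  "left_part z = (\<chi> i. z $ Inl i)"

definition right_part :: "'a ^ ('n::finite + 'l::finite) \<Rightarrow> 'a ^ 'l" where
  "right_part z = (\<chi> j. z $ Inr j)"

definition join :: "'a ^ 'n \<Rightarrow> 'a ^ 'l \<Rightarrow> 'a ^ ('n::finite + 'l::finite)" where
  "join u v = (\<chi> k. case k of Inl i \<Rightarrow> u $ i | Inr j \<Rightarrow> v $ j)"

definition graph :: "'a::semiring_1 ^ 'n ^ 'l \<Rightarrow> ('a ^ ('n::finite + 'l::finite)) set" where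
  "graph A = range (\<lambda>u. join u (A *v u))"

lemma left_part_join [simp]: "left_part (join u v) = u"
  by (simp add: left_part_def join_def vec_eq_iff)

lemma right_part_join [simp]: "right_part (join u v) = v"
  by (simp add: right_part_def join_def vec_eq_iff)

lemma join_parts [simp]: "join (left_part z) (right_part z) = z"
  by (simp add: left_part_def right_part_def join_def vec_eq_iff split: sum.split)

lemma join_eq_iff [simp]: "join u v = join u' v' \<longleftrightarrow> u = u' \<and> v = v'"
  by (metis left_part_join right_part_join)

lemma join_add: "join (u + u') (v + v') = join u v + join u' v'"
  by (simp add: join_def vec_eq_iff split: sum.split)

lemma join_scale: "join (c *s u) (c *s v) = c *s join u v"
  by (simp add: join_def vec_eq_iff split: sum.split)

lemma join_0 [simp]: "join 0 0 = 0"
  by (simp add: join_def vec_eq_iff split: sum.split)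

lemma join_eq_0_iff [simp]: "join u v = 0 \<longleftrightarrow> u = 0 \<and> v = 0"
  by (metis join_0 join_eq_iff)

lemma left_part_linear:
  "left_part (z + z') = left_part z + left_part z'" "left_part (z - z') = left_part z - left_part z'"
  "left_part (c *s z) = c *s left_part z" "left_part 0 = 0"
  by (simp_all add: left_part_def vec_eq_iff)

lemma left_part_sum: "left_part (sum f I) = (\<Sum>i\<in>I. left_part (f i))"
  by (simp add: left_part_def vec_eq_iff)

text \<open>Identifies \<open>E_space\<close> as the kernel of the projection
  \<open>left_part\<close>.\<close>

lemma mem_E_space_iff:
  fixes z :: "'a::{field,finite} ^ ('n::finite + 'l::finite)"
  shows "z \<in> E_space \<longleftrightarrow> left_part z = 0"
proof
  let ?K = "{z :: 'a ^ ('n + 'l). left_part z = 0}"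
  have "vec.subspace ?K" by (rule vec.subspaceI) (simp_all add: left_part_linear)
  moreover have "range (\<lambda>j. axis (Inr j) 1) \<subseteq> ?K"
    by (auto simp: left_part_def axis_def vec_eq_iff)
  ultimately have "E_space \<subseteq> ?K" unfolding E_space_def by (intro vec.span_minimal)
  then show "z \<in> E_space \<Longrightarrow> left_part z = 0" by blast
next
  assume z: "left_part z = 0"
  have "z = (\<Sum>k\<in>UNIV. z $ k *s axis k 1)" by (rule basis_expansion[symmetric])
  also have "\<dots> \<in> E_space"
  proof (unfold E_space_def, rule vec.span_sum)
    fix k show "z $ k *s axis k 1 \<in> vec.span (range (\<lambda>j. axis (Inr j) 1))"
    proof (cases k)
      case (Inl i)
      have "left_part z $ i = 0" using z by simp
      then have "z $ k = 0" by (simp add: left_part_def Inl)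
      then show ?thesis by (simp add: vec.span_zero)
    next
      case (Inr j)
      then show ?thesis by (intro vec.span_scale vec.span_base) auto
    qed
  qed
  finally show "z \<in> E_space" .
qed

lemma mem_graph_iff: "z \<in> graph A \<longleftrightarrow> right_part z = A *v left_part z"
proof
  assume "right_part z = A *v left_part z"
  then have "z = join (left_part z) (A *v left_part z)" by (metis join_parts)
  then show "z \<in> graph A" unfolding graph_def by (rule image_eqI) simp
qed (auto simp: graph_def)

lemma subspace_graph: "vec.subspace (graph (A :: 'a::{field,finite} ^ 'n::finite ^ 'l::finite))"
proof (rule vec.subspaceI)
  show "0 \<in> graph A" by (simp add: mem_graph_iff left_part_def right_part_def vec_eq_iff matrix_vector_mult_def)
next
  fix y z assume "y \<in> graph A" "z \<in> graph A"
  then obtain u w where "y = join u (A *v u)" "z = join w (A *v w)" by (auto simp: graph_def)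
  then have "y + z = join (u + w) (A *v (u + w))" by (simp add: join_add matrix_vector_right_distrib)
  then show "y + z \<in> graph A" by (simp add: mem_graph_iff)
next
  fix c z assume "z \<in> graph A"
  then obtain u where "z = join u (A *v u)" by (auto simp: graph_def)
  then have "c *s z = join (c *s u) (A *v (c *s u))" by (simp add: join_scale vec.scale)
  then show "c *s z \<in> graph A" by (simp add: mem_graph_iff)
qed

lemma graph_Int_E_space: "graph (A :: 'a::{field,finite} ^ 'n::finite ^ 'l::finite) \<inter> E_space = {0}"
  by (auto simp: graph_def mem_E_space_iff image_iff left_part_linear intro!: exI[of _ 0])

lemma dim_graph: "vec.dim (graph (A :: 'a::{field,finite} ^ 'n::finite ^ 'l::finite)) = CARD('n)"
proof -
  have "Vector_Spaces.linear (*s) (*s) (\<lambda>u. join u (A *v u))"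
    by (rule Vector_Spaces.linear.intro)
      (unfold_locales, simp_all add: join_add join_scale matrix_vector_right_distrib vec.scale)
  then have "vec.dim (range (\<lambda>u. join u (A *v u))) = vec.dim (UNIV :: ('a ^ 'n) set)"
    by (rule vec.dim_image_eq) (auto simp: inj_on_def)
  then show ?thesis by (simp only: graph_def vec_dim_card)
qed

text \<open>Trivial intersection with \<open>E_space\<close> makes \<open>left_part\<close>
  injective on \<open>P\<close>; by dimension it is then a bijection onto the first factor.\<close>

lemma bil_vertices_eq_graph:
  fixes P :: "('a::{field,finite} ^ ('n::finite + 'l::finite)) set"
  assumes P: "P \<in> bil_vertices"
  shows "\<exists>A. P = graph A"
proof -
  have sub: "vec.subspace P" and dim: "vec.dim P = CARD('n)" and E: "P \<inter> E_space = {0}"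
    using P by (auto simp: M_set_def)
  have lin: "Vector_Spaces.linear (*s) (*s) (left_part :: 'a ^ ('n + 'l) \<Rightarrow> 'a ^ 'n)"
    by (rule Vector_Spaces.linear.intro) (unfold_locales, simp_all add: left_part_linear)
  have inj: "y = z" if "y \<in> P" "z \<in> P" "left_part y = left_part z" for y z
  proof -
    have "y - z \<in> P \<inter> E_space"
      using that vec.subspace_diff[OF sub] by (simp add: mem_E_space_iff left_part_linear)
    then show ?thesis using E by auto
  qed
  have "vec.dim (left_part ` P) = CARD('n)"
    using vec.dim_image_eq[OF lin, of P] inj dim sub by (simp only: inj_on_def vec.span_eq_iff[THEN iffD2]) blast
  then have "left_part ` P = UNIV"
    by (intro vec.subspace_dim_equal vec.linear_subspace_image[OF lin sub])
      (simp_all only: vec.subspace_UNIV vec_dim_card subset_UNIV order_refl)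
  then have "\<exists>p. p \<in> P \<and> left_part p = axis i 1" for i
    using imageE[of "axis i 1" left_part P] by (metis UNIV_I)
  then obtain p where p: "\<And>i. p i \<in> P" "\<And>i. left_part (p i) = axis i 1" by metis
  \<comment> \<open>The columns are the right parts of the vectors of \<open>P\<close> lying over
    the standard basis. Linearity gives \<open>P \<subseteq> graph A\<close>, and equal dimensions
    give equality.\<close>
  define A :: "'a ^ 'n ^ 'l" where "A = (\<chi> j i. right_part (p i) $ j)"
  have "z \<in> graph A" if z: "z \<in> P" for z
  proof -
    define w where "w = (\<Sum>i\<in>UNIV. left_part z $ i *s p i)"
    have "w \<in> P" unfolding w_def by (intro vec.subspace_sum[OF sub] vec.subspace_scale[OF sub] p)
    moreover have "left_part w = left_part z"
      by (simp add: w_def left_part_sum left_part_linear p basis_expansion)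
    ultimately have "w = z" using z inj by blast
    moreover have "right_part w = A *v left_part w"
      unfolding \<open>left_part w = left_part z\<close>
      by (simp add: w_def A_def right_part_def matrix_vector_mult_def vec_eq_iff mult.commute)
    ultimately show ?thesis by (simp add: mem_graph_iff)
  qed
  then have "P = graph A"
    using vec.subspace_dim_equal[OF sub subspace_graph[of A]] by (auto simp: dim dim_graph)
  then show ?thesis ..
qed

lemma inj_graph: "inj (graph :: 'a::{field,finite} ^ 'n::finite ^ 'l::finite \<Rightarrow> _)"
proof (rule injI)
  fix A B :: "'a ^ 'n ^ 'l"
  assume "graph A = graph B"
  then have "A *v u = B *v u" for u
    using mem_graph_iff[of "join u (A *v u)" A] mem_graph_iff[of "join u (A *v u)" B] by simp
  then show "A = B" by (simp add: matrix_eq)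
qed

lemma graph_in_bil_vertices: "graph (A :: 'a::{field,finite} ^ 'n::finite ^ 'l::finite) \<in> bil_vertices"
  by (simp add: M_set_def subspace_graph dim_graph graph_Int_E_space)

section \<open>One-dimensional subspaces and the incidence matrix\<close>

lemma span_singleton_eq: "vec.span {z} = range (\<lambda>c. c *s (z :: 'a::field ^ 'm::finite))"
  by (rule vec.span_singleton)

lemma subspace_dim_1_eq_span:
  fixes P :: "('a::field ^ 'm::finite) set"
  assumes "vec.subspace P" "vec.dim P = 1" "z \<in> P" "z \<noteq> 0"
  shows "P = vec.span {z}"
proof (rule sym, rule vec.subspace_dim_equal)
  show "vec.span {z} \<subseteq> P" using assms by (simp add: vec.span_minimal)
qed (use assms in \<open>simp_all add: vec.subspace_span\<close>)

lemma card_subspace_dim_1: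
  fixes P :: "('a::{field,finite} ^ 'm::finite) set"
  assumes "vec.subspace P" "vec.dim P = 1"
  shows "card (P - {0}) = CARD('a) - 1"
proof -
  have "\<not> P \<subseteq> {0}" using assms(2) vec.dim_eq_0[of P] by auto
  then obtain z where z: "z \<in> P" "z \<noteq> 0" by blast
  have "P = range (\<lambda>c. c *s z)"
    using subspace_dim_1_eq_span[OF assms z] by (simp only: span_singleton_eq)
  moreover have "inj (\<lambda>c. c *s z)" using z(2) by (auto simp: inj_def vec_eq_iff)
  ultimately have "card P = CARD('a)" by (simp add: card_image)
  moreover have "0 \<in> P" using assms(1) by (rule vec.subspace_0)
  ultimately show ?thesis by (simp add: card_Diff_subset)
qed

text \<open>Every one-dimensional subspace of \<open>graph A\<close> is spanned by
  \<open>join u (A *v u)\<close> for exactly \<open>CARD('a) - 1\<close> nonzero vectors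
  \<open>u\<close>, so the left sum is grouped by span.\<close>

lemma sum_incidence_graph:
  fixes A :: "'a::{field,finite} ^ 'n::finite ^ 'l::finite" and w :: "('a ^ ('n + 'l)) set \<Rightarrow> real"
  shows "(\<Sum>u\<in>UNIV - {0}. w (vec.span {join u (A *v u)})) =
    (real CARD('a) - 1) * (\<Sum>P\<in>M_set 1. incidence P (graph A) * w P)"
proof -
  let ?s = "\<lambda>u. vec.span {join u (A *v u)}"
  let ?T = "{P \<in> M_set 1. P \<subseteq> graph A}"
  have sub: "?s u \<subseteq> graph A" for u
    by (rule vec.span_minimal) (auto simp: subspace_graph mem_graph_iff)
  have "?s u \<in> M_set 1" if "u \<noteq> 0" for u
  proof -
    have "0 \<in> ?s u" by (rule vec.span_zero)
    then have "?s u \<inter> E_space = {0}" using sub[of u] graph_Int_E_space[of A] by blast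
    moreover have "vec.dim (?s u) = 1" using that by (simp only: vec.dim_span vec.dim_singleton) simp
    ultimately show ?thesis using vec.subspace_span unfolding M_set_def by blast
  qed
  then have "(\<Sum>u\<in>UNIV - {0}. w (?s u)) = (\<Sum>P\<in>?T. \<Sum>u\<in>{u \<in> UNIV - {0}. ?s u = P}. w (?s u))"
    using sub by (intro sum.group[symmetric] finite image_subsetI) (simp_all only: mem_Collect_eq Diff_iff, blast)
  also have "\<dots> = (\<Sum>P\<in>?T. (real CARD('a) - 1) * w P)"
  proof (rule sum.cong)
    fix P assume "P \<in> ?T"
    then have P: "vec.subspace P" "vec.dim P = 1" "P \<subseteq> graph A" unfolding M_set_def by blast+
    have "(\<lambda>u. join u (A *v u)) ` {u \<in> UNIV - {0}. ?s u = P} = P - {0}"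
    proof (intro equalityI subsetI)
      fix z assume "z \<in> (\<lambda>u. join u (A *v u)) ` {u \<in> UNIV - {0}. ?s u = P}"
      then obtain u where u: "z = join u (A *v u)" "u \<noteq> 0" "?s u = P" by blast
      have "z \<in> ?s u" unfolding u(1) by (intro vec.span_base) simp
      moreover have "z \<noteq> 0" using u(1,2) by simp
      ultimately show "z \<in> P - {0}" using u(3) by blast
    next
      fix z assume z: "z \<in> P - {0}"
      then obtain u where u: "z = join u (A *v u)" using P(3) by (auto simp: graph_def)
      then have "u \<noteq> 0" using z by auto
      moreover have "?s u = P" using subspace_dim_1_eq_span[OF P(1,2), of z] z u by blast
      ultimately show "z \<in> (\<lambda>u. join u (A *v u)) ` {u \<in> UNIV - {0}. ?s u = P}" using u by blast
    qed
    moreover have "inj_on (\<lambda>u. join u (A *v u)) {u \<in> UNIV - {0}. ?s u = P}" by (simp add: inj_on_def)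
    ultimately have "bij_betw (\<lambda>u. join u (A *v u)) {u \<in> UNIV - {0}. ?s u = P} (P - {0})"
      by (rule bij_betw_imageI[rotated])
    then have c: "card {u \<in> UNIV - {0}. ?s u = P} = CARD('a) - 1"
      by (rule bij_betw_same_card[THEN trans, OF _ card_subspace_dim_1[OF P(1,2)]])
    have "(\<Sum>u\<in>{u \<in> UNIV - {0}. ?s u = P}. w (?s u)) = (\<Sum>u\<in>{u \<in> UNIV - {0}. ?s u = P}. w P)"
      by (intro sum.cong refl) (simp only: mem_Collect_eq)
    also have "\<dots> = (real CARD('a) - 1) * w P"
      unfolding sum_constant c by (simp add: of_nat_diff Suc_leI)
    finally show "(\<Sum>u\<in>{u \<in> UNIV - {0}. ?s u = P}. w (?s u)) = (real CARD('a) - 1) * w P" .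
  qed simp
  also have "\<dots> = (real CARD('a) - 1) * (\<Sum>P\<in>M_set 1. incidence P (graph A) * w P)"
  proof -
    have "(\<Sum>P\<in>M_set 1. incidence P (graph A) * w P) = (\<Sum>P\<in>?T. w P)"
    proof (rule sum.mono_neutral_cong_right)
      show "\<forall>P\<in>M_set 1 - ?T. incidence P (graph A) * w P = 0" by (simp add: incidence_def)
      show "incidence P (graph A) * w P = w P" if "P \<in> ?T" for P
        using that by (simp add: incidence_def)
    qed (rule finite, blast)
    then show ?thesis by (simp only: sum_distrib_left)
  qed
  finally show ?thesis .
qed

lemma cameron_liebler_boolean_degree_one:
  fixes L :: "('a::{field,finite} ^ ('n::finite + 'l::finite)) set set"
  assumes L: "char_vec L \<in> image_transpose"
  shows "\<exists>k h. boolean_degree_one {A. graph A \<in> L} k h (real CARD('a))"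
proof -
  let ?q = "real CARD('a)"
  have "card {0 :: 'a, 1} \<le> CARD('a)" by (rule card_mono) auto
  then have q: "?q - 1 \<noteq> 0" by simp
  obtain w where w: "char_vec L = transpose_mult w" using L by (auto simp: image_transpose_def)
  \<comment> \<open>Division by \<open>?q - 1\<close> compensates for the representatives of each
    point. The value 0 is set at \<open>u = 0\<close>, where \<open>join u v\<close> lies in
    \<open>E_space\<close>.\<close>
  define g where "g u v = (if u = 0 then 0 else w (vec.span {join u v}) / (?q - 1))"
    for u :: "'a ^ 'n" and v :: "'a ^ 'l"
  show ?thesis
  proof (rule boolean_degree_one_centre)
    fix c :: 'a and u :: "'a ^ 'n" and v :: "'a ^ 'l" assume "c \<noteq> 0"
    then show "g (c *s u) (c *s v) = g u v"
      using vec.span_image_scale[of "{join u v}" "\<lambda>_. c"] by (simp add: g_def join_scale)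
  next
    fix v show "g 0 v = 0" by (simp add: g_def)
  next
    fix A :: "'a ^ 'n ^ 'l"
    have "indicator {A. graph A \<in> L} A = char_vec L (graph A)"
      by (simp add: char_vec_def graph_in_bil_vertices indicator_def)
    also have "\<dots> = (\<Sum>P\<in>M_set 1. incidence P (graph A) * w P)"
      by (simp add: w transpose_mult_def graph_in_bil_vertices)
    also have "\<dots> = (\<Sum>u\<in>UNIV - {0}. w (vec.span {join u (A *v u)})) / (?q - 1)"
      using q by (simp add: sum_incidence_graph)
    also have "\<dots> = (\<Sum>u\<in>UNIV - {0}. g u (A *v u))" by (simp add: g_def sum_divide_distrib)
    also have "\<dots> = (\<Sum>u\<in>UNIV. g u (A *v u))" by (simp add: sum.remove[of UNIV 0] g_def)
    finally show "indicator {A. graph A \<in> L} A = (\<Sum>u\<in>UNIV. g u (A *v u))" .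
  qed
qed

text \<open>All members contain the nonzero vector \<open>join u v\<close>.\<close>

lemma intersecting_family_pencil:
  fixes u :: "'a::{field,finite} ^ 'n::finite" and v :: "'a ^ 'l::finite"
  assumes "u \<noteq> 0"
  shows "intersecting_family (graph ` {A. A *v u = v})"
  unfolding intersecting_family_def
proof (intro conjI ballI)
  fix P Q assume "P \<in> graph ` {A. A *v u = v}" "Q \<in> graph ` {A. A *v u = v}"
  then have "join u v \<in> P \<inter> Q" by (auto simp: mem_graph_iff)
  moreover have "join u v \<noteq> 0" using assms by simp
  ultimately have "vec.dim (P \<inter> Q) \<noteq> 0" unfolding vec.dim_eq_0 by blast
  then show "1 \<le> vec.dim (P \<inter> Q)" by linarith
qed (auto simp: graph_in_bil_vertices)

section \<open>The numerical bound and the conclusion\<close>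

text \<open>Supplies the hypothesis of \<open>pencil_union\<close>, since
  \<open>x = h * q ^ l\<close> there. Squaring removes the half-integral exponents, and the square
  is at most 4/27, just below 4/25.\<close>

lemma parameter_bound:
  fixes q x :: real
  assumes q: "2 \<le> q" and n: "2 \<le> n" and l: "2 * n \<le> l" and x: "0 \<le> x"
    and le: "x \<le> (q - 1) powr (real n / 2) * q powr ((real l - 2 * real n + 1) / 2)"
  shows "x * q ^ n / q ^ l < 2 / 5"
proof -
  define t where "t = x * q ^ n / q ^ l"
  have sq: "(a powr (b / 2))\<^sup>2 = a powr b" for a b :: real
    by (simp add: power2_eq_square powr_add[symmetric])
  have "x\<^sup>2 \<le> ((q - 1) powr (real n / 2) * q powr ((real l - 2 * real n + 1) / 2))\<^sup>2"
    using le x by (rule power_mono)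
  also have "\<dots> = (q - 1) powr (real n) * q powr (real l - 2 * real n + 1)"
    by (simp only: power_mult_distrib sq)
  also have "(q - 1) powr (real n) = (q - 1) ^ n" using q by (simp add: powr_realpow)
  also have "real l - 2 * real n + 1 = real (l - 2 * n + 1)" using l by (simp add: of_nat_diff)
  also have "q powr real (l - 2 * n + 1) = q ^ (l - 2 * n + 1)" using q by (intro powr_realpow) simp
  finally have "x\<^sup>2 \<le> (q - 1) ^ n * q ^ (l - 2 * n + 1)" .
  then have "x\<^sup>2 * q ^ (2 * n) \<le> (q - 1) ^ n * (q ^ (l - 2 * n + 1) * q ^ (2 * n))"
    using q by (simp add: mult.assoc[symmetric] mult_right_mono)
  also have "q ^ (l - 2 * n + 1) * q ^ (2 * n) = q ^ (l + 1)"
    using l by (simp only: power_add[symmetric]) simp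
  finally have 1: "x\<^sup>2 * q ^ (2 * n) \<le> (q - 1) ^ n * q ^ (l + 1)" .
  have "t\<^sup>2 = x\<^sup>2 * q ^ (2 * n) / (q ^ l * q ^ l)"
    by (simp add: t_def power_divide power_mult_distrib power_mult[symmetric] power_add[symmetric] mult_2_right mult.commute)
  also have "\<dots> \<le> (q - 1) ^ n * q ^ (l + 1) / (q ^ l * q ^ l)"
    using 1 q by (intro divide_right_mono) auto
  also have "\<dots> = (q - 1) ^ n * q / q ^ l" using q by (simp add: field_simps)
  also have "\<dots> \<le> (q - 1) ^ n * q / q ^ (2 * n)"
    using q l by (intro divide_left_mono power_increasing) auto
  also have "\<dots> = q * ((q - 1) / q\<^sup>2) ^ n" by (simp add: power_divide power_mult)
  also have "\<dots> \<le> q * ((q - 1) / q\<^sup>2)\<^sup>2"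
  proof (intro mult_left_mono power_decreasing n)
    have "q * 1 \<le> q * q" using q by (intro mult_left_mono) auto
    then have "q - 1 \<le> q\<^sup>2" by (simp add: power2_eq_square)
    then show "(q - 1) / q\<^sup>2 \<le> 1" using q by simp
  qed (use q in auto)
  also have "\<dots> \<le> 4 / 27"
  proof -
    \<comment> \<open>This product is \<open>4 * q ^ 3 - 27 * (q - 1)\<^sup>2\<close>; the double
      root reflects that \<open>(q - 1)\<^sup>2 / q ^ 3\<close> is maximal at
      \<open>q = 3\<close>.\<close>
    have "0 \<le> (q - 3)\<^sup>2 * (4 * q - 3)" using q by simp
    then have "27 * (q - 1)\<^sup>2 \<le> 4 * q ^ 3" by (simp add: algebra_simps power2_eq_square power3_eq_cube)
    then have "(q - 1)\<^sup>2 / q ^ 3 \<le> 4 / 27" using q by (simp add: field_simps)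
    moreover have "q * ((q - 1) / q\<^sup>2)\<^sup>2 = (q - 1)\<^sup>2 / q ^ 3"
      using q by (simp add: power_divide power2_eq_square power3_eq_cube)
    ultimately show ?thesis by simp
  qed
  also have "(4 :: real) / 27 < (2 / 5)\<^sup>2" by (simp add: power2_eq_square)
  finally have "t < 2 / 5" by (rule power_less_imp_less_base) simp
  then show ?thesis by (simp only: t_def)
qed

theorem theorem4p10:
  fixes L :: "('a::{field,finite} ^ ('n::finite + 'l::finite)) set set"
    and q n l :: nat and x :: real
  assumes "q = CARD('a)" and "n = CARD('n)" and "l = CARD('l)"
    and "l \<ge> 2 * n" and "2 * n \<ge> 4"
    and "2 \<le> x"
    and "x \<le> (real q - 1) powr (real n / 2) * real q powr ((real l - 2 * real n + 1) / 2)"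
    and "cameron_liebler x L"
  shows "trivial_with_parameter x L"
proof -
  let ?M = "{A :: 'a ^ 'n ^ 'l. graph A \<in> L}"
  have LV: "L \<subseteq> bil_vertices" and im: "char_vec L \<in> image_transpose"
    and x: "x = real (card L) / real q ^ ((n - 1) * l)"
    using assms(1-3,8) by (simp_all add: cameron_liebler_def)
  obtain k h where "boolean_degree_one ?M k h (real q)"
    using cameron_liebler_boolean_degree_one[OF im] assms(1) by blast
  then interpret boolean_degree_one ?M k h "real q" .
  have q: "2 \<le> real q" by (rule q_ge_2)
  have split: "n * l = (n - 1) * l + l" using assms(5) by (simp add: algebra_simps diff_mult_distrib)
  have L: "L = graph ` ?M" using LV bil_vertices_eq_graph by blast
  have cardL: "card L = card ?M"
    by (subst L, rule card_image) (rule inj_on_subset[OF inj_graph subset_UNIV])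
  have "x = h * real q ^ l"
  proof -
    have "real (card L) = h * real q ^ (n * l)"
      using card_eq by (simp only: cardL) (simp add: assms(1-3) power_mult)
    then show ?thesis using q by (simp add: x split power_add)
  qed
  then have "h * real q ^ n = x * real q ^ n / real q ^ l" using q by simp
  also have "\<dots> < 2 / 5"
    using assms(4-7) q by (intro parameter_bound) auto
  finally obtain u V where u: "u \<noteq> 0" and V: "?M = {A. A *v u \<in> V}"
    using pencil_union assms(2,5) by auto
  \<comment> \<open>\<open>L\<close> is the disjoint union of \<open>card V\<close> pencils of size
    \<open>q ^ ((n - 1) * l)\<close>; in particular \<open>x\<close> is a natural number.\<close>
  have "real (card V) = x"
  proof -
    have c: "card {A :: 'a ^ 'n ^ 'l. A *v u = v} = q ^ ((n - 1) * l)" for v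
    proof -
      have "card {A :: 'a ^ 'n ^ 'l. A *v u = v} * q ^ l = q ^ ((n - 1) * l) * q ^ l"
        using card_pencil[OF u, of v] split by (simp only: assms(1-3) power_add)
      then show ?thesis using q by simp
    qed
    have "card ?M = card (\<Union>v\<in>V. {A. A *v u = v})" unfolding V by (rule arg_cong[where f = card]) auto
    also have "\<dots> = (\<Sum>v\<in>V. card {A :: 'a ^ 'n ^ 'l. A *v u = v})" by (rule card_UN_disjoint) auto
    also have "\<dots> = card V * q ^ ((n - 1) * l)" by (simp add: c)
    finally show ?thesis using q by (simp add: x cardL)
  qed
  moreover obtain e where e: "bij_betw e {0..<card V} V"
    using ex_bij_betw_nat_finite[of V] finite[of V] by blast
  \<comment> \<open>One intersecting family for each value in \<open>V\<close>, enumerated by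
    \<open>e\<close>.\<close>
  define F where "F i = (graph :: 'a ^ 'n ^ 'l \<Rightarrow> _) ` {A. A *v u = e i}" for i
  have "L = (\<Union>i<card V. F i)"
  proof -
    have "V = e ` {..<card V}" using e by (simp add: bij_betw_def lessThan_atLeast0)
    then have "?M = (\<Union>i<card V. {A. A *v u = e i})" unfolding V by blast
    then show ?thesis unfolding F_def by (subst L) (simp only: image_UN)
  qed
  moreover have "\<forall>i<card V. intersecting_family (F i)"
    unfolding F_def using intersecting_family_pencil[OF u] by blast
  ultimately show ?thesis unfolding trivial_with_parameter_def by blast
qed

end
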